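(* For the $D_2$-equivariant four-vortex problem, the projection to the configuration space of any generalized solution is bounded; that is, for every generalized solution $\vec q:J\to\mathbb{R}^2$ the set $\{\vec q(\sigma):\sigma\in J\}$ is bounded in $\mathbb{R}^2$.
   Context: Four vortices are located at $(\pm q_1,\pm q_2)$ in the plane (an orbit of the Klein group $D_2$), with $\vec q=(q_1,q_2)$ obeying $\pi\,\ddot{\vec q}=\partial U/\partial \vec q$, $U(\vec q)=-\log(8\|\vec q\|\,|q_1q_2|)$, and conserved total energy $h=\frac{\pi}{2}\|\dot{\vec q}\|^2-U(\vec q)$. A binary collision is an instant at which exactly one of $q_1,q_2$ vanishes. A generalized solution on an interval $J$ is a curve $\vec q\in C^0(J)\cap C^2(J\setminus Y)$, $Y\subset J$ a finite set, which satisfies the equation of motion pointwise on $J\setminus Y$ and which at the instants of $Y$ has a binary collision and is continued by transmission: the vanishing coordinate passes through zero and changes sign, the other coordinate and its momentum are continuous, and the energy is unchanged. *)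

theory Defs
  imports "HOL-Analysis.Analysis"
begin

text \<open>
  The four vortices sit at \<open>(\<plusminus>q\<^sub>1, \<plusminus>q\<^sub>2)\<close>; the configuration is recorded by
  \<open>q = (q\<^sub>1, q\<^sub>2)\<close>, and the momentum is \<open>\<pi>\<close> times the velocity.
\<close>

definition potential :: "real ^ 2 \<Rightarrow> real" where
  "potential x = - ln (8 * norm x * \<bar>x $ 1 * x $ 2\<bar>)"

definition energy :: "real ^ 2 \<Rightarrow> real ^ 2 \<Rightarrow> real" where
  "energy x v = pi / 2 * (norm v)\<^sup>2 - potential x"

definition collision_free :: "real ^ 2 \<Rightarrow> bool" where
  "collision_free x \<longleftrightarrow> x $ 1 \<noteq> 0 \<and> x $ 2 \<noteq> 0"

definition binary_collision :: "real ^ 2 \<Rightarrow> bool" where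
  "binary_collision x \<longleftrightarrow> (x $ 1 = 0) \<noteq> (x $ 2 = 0)"

text \<open>
  \<open>q\<close> is of class \<open>C\<^sup>2\<close> on \<open>J - Y\<close> with velocity \<open>v\<close> and solves
  \<open>\<pi> q'' = \<partial>U/\<partial>q\<close> there. As \<open>Y\<close> will be finite, derivatives within \<open>J\<close> at a point outside
  \<open>Y\<close> are derivatives within \<open>J - Y\<close>; they are one-sided at endpoints belonging to \<open>J\<close>.
  Freedom from collisions is required explicitly because \<open>ln 0\<close> is defined in HOL.
\<close>

definition solves_motion ::
  "real set \<Rightarrow> real set \<Rightarrow> (real \<Rightarrow> real ^ 2) \<Rightarrow> (real \<Rightarrow> real ^ 2) \<Rightarrow> bool" where
  "solves_motion J Y q v \<longleftrightarrow>
     (\<exists>a. continuous_on (J - Y) a \<and>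
       (\<forall>t \<in> J - Y.
          collision_free (q t) \<and>
          (q has_vector_derivative v t) (at t within J) \<and>
          (v has_vector_derivative a t) (at t within J) \<and>
          GDERIV potential (q t) :> pi *\<^sub>R a t))"

text \<open>
  Transmission through a collision at time \<open>y\<close>. If \<open>y\<close> is an endpoint of \<open>J\<close>, there is nothing
  to be transmitted to: the sign condition is then void, and the conditions on the other
  coordinate and on the energy are one-sided. The value of \<open>v y\<close> matters only in the
  coordinate that does not vanish. Between collisions the energy is conserved by the equation of
  motion, so it is unchanged at \<open>y\<close> iff it has one and the same value just before and just
  after \<open>y\<close>.
\<close>

definition transmission ::
  "real set \<Rightarrow> (real \<Rightarrow> real ^ 2) \<Rightarrow> (real \<Rightarrow> real ^ 2) \<Rightarrow> real \<Rightarrow> bool" where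
  "transmission J q v y \<longleftrightarrow>
     (\<forall>i. q y $ i = 0 \<longrightarrow>
        (\<exists>\<epsilon>>0. \<forall>s \<in> J. \<forall>t \<in> J. y - \<epsilon> < s \<and> s < y \<and> y < t \<and> t < y + \<epsilon> \<longrightarrow>
           q s $ i * q t $ i < 0)) \<and>
     (\<forall>j. q y $ j \<noteq> 0 \<longrightarrow>
        continuous (at y within J) (\<lambda>t. q t $ j) \<and>
        ((\<lambda>t. q t $ j) has_real_derivative v y $ j) (at y within J) \<and>
        continuous (at y within J) (\<lambda>t. pi * v t $ j)) \<and>
     (\<exists>h. \<forall>\<^sub>F t in at y within J. energy (q t) (v t) = h)"

definition generalized_solution :: "real set \<Rightarrow> (real \<Rightarrow> real ^ 2) \<Rightarrow> bool" where
  "generalized_solution J q \<longleftrightarrow>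
     is_interval J \<and> continuous_on J q \<and>
     (\<exists>Y v. finite Y \<and> Y \<subseteq> J \<and> solves_motion J Y q v \<and>
        (\<forall>y \<in> Y. binary_collision (q y) \<and> transmission J q v y))"

end

theory Submission imports Defs begin

text \<open>
  The force on each coordinate points towards the collision axis and is at least as strong as that
  of the one-dimensional potential \<open>- ln \<bar>x\<bar>\<close>: since
  \<open>\<pi> q\<^sub>i'' = - (1 / q\<^sub>i + q\<^sub>i / \<parallel>q\<parallel>\<^sup>2)\<close>, one has \<open>\<pi> q\<^sub>i'' q\<^sub>i \<le> - 1\<close>
  (\<open>gradient_potential_times_coordinate\<close>). Hence, for a coordinate \<open>x > 0\<close> with velocity \<open>v\<close>, the
  quantity \<open>\<pi>/2 (max v 0)\<^sup>2 + ln x\<close>, the one-dimensional energy with only outward motion counted,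
  does not increase in time. It dominates \<open>ln x\<close>, and reversing time treats the past in the same way, so
  on an interval free of collisions \<open>x\<close> never exceeds \<open>x\<^sub>0 exp (\<pi>/2 v\<^sub>0\<^sup>2)\<close>, where \<open>x\<^sub>0\<close> and
  \<open>v\<^sub>0\<close> are position and velocity at any one time of that interval
  (\<open>log_attraction_bounded\<close>). This needs neither a bound on the length of the interval nor any
  information at its ends. Finitely many collision times cut \<open>J\<close> into finitely many such
  intervals.
\<close>

lemma has_real_derivative_max_0_power2:
  fixes x :: real
  shows "((\<lambda>v. (max v 0)\<^sup>2) has_real_derivative 2 * max x 0) (at x)"
proof (cases x "0::real" rule: linorder_cases)
  case less
  have "((\<lambda>v::real. 0) has_real_derivative 2 * max x 0) (at x)"
    using less by simp
  then show ?thesis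
    by (rule has_field_derivative_transform_within_open[where S = "{..<0}"]) (use less in auto)
next
  case greater
  have "((\<lambda>v. v\<^sup>2) has_real_derivative 2 * max x 0) (at x)"
    using greater by (auto intro!: derivative_eq_intros)
  then show ?thesis
    by (rule has_field_derivative_transform_within_open[where S = "{0<..}"]) (use greater in auto)
next
  case equal
  have "((\<lambda>v::real. max v 0) \<longlongrightarrow> max 0 0) (at 0)"
    by (intro tendsto_intros)
  moreover have "(max h 0)\<^sup>2 / h = max h 0" if "h \<noteq> 0" for h :: real
    using that by (auto simp: max_def power2_eq_square)
  ultimately have "((\<lambda>h::real. (max h 0)\<^sup>2 / h) \<longlongrightarrow> 0) (at 0)"
    by (auto elim!: Lim_transform_eventually simp: eventually_at_filter)
  then show ?thesis
    using equal by (simp add: DERIV_def)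
qed

text \<open>
  The bound for later times: \<open>\<pi>/2 (max v 0)\<^sup>2 + ln x\<close> is nonincreasing. Discarding inward motion
  is essential, since the full energy \<open>\<pi>/2 v\<^sup>2 + ln x\<close> may increase while \<open>v < 0\<close>.
\<close>

lemma log_attraction_forward_bound:
  fixes x v a :: "real \<Rightarrow> real"
  assumes "s \<le> t"
    and x: "\<And>r. r \<in> {s..t} \<Longrightarrow> (x has_real_derivative v r) (at r within {s..t})"
    and v: "\<And>r. r \<in> {s..t} \<Longrightarrow> (v has_real_derivative a r) (at r within {s..t})"
    and pos: "\<And>r. r \<in> {s..t} \<Longrightarrow> x r > 0"
    and a: "\<And>r. r \<in> {s..t} \<Longrightarrow> pi * a r * x r \<le> - 1"
  shows "x t \<le> x s * exp (pi / 2 * (v s)\<^sup>2)"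
proof -
  define G where "G r = pi / 2 * (max (v r) 0)\<^sup>2 + ln (x r)" for r
  have dG: "(G has_real_derivative pi * max (v r) 0 * a r + v r / x r) (at r within {s..t})"
    if r: "r \<in> {s..t}" for r
  proof -
    have sq: "((\<lambda>r. (max (v r) 0)\<^sup>2) has_real_derivative 2 * max (v r) 0 * a r) (at r within {s..t})"
      using DERIV_chain2[OF has_real_derivative_max_0_power2 v[OF r]] .
    have "(G has_real_derivative
        pi / 2 * (2 * max (v r) 0 * a r) + inverse (x r) * v r) (at r within {s..t})"
      unfolding G_def
      by (intro DERIV_add DERIV_cmult DERIV_chain2[OF DERIV_ln] sq x[OF r] pos[OF r])
    then show ?thesis
      by (simp add: field_simps)
  qed
  have dG_nonpos: "pi * max (v r) 0 * a r + v r / x r \<le> 0" if r: "r \<in> {s..t}" for r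
  proof -
    have "pi * a r \<le> - 1 / x r"
      using a[OF r] pos[OF r] pos_le_divide_eq[of "x r" "pi * a r" "- 1"] by blast
    then have "max (v r) 0 * (pi * a r) \<le> max (v r) 0 * (- 1 / x r)"
      by (intro mult_left_mono) auto
    moreover have "v r / x r \<le> max (v r) 0 / x r"
      using pos[OF r] by (intro divide_right_mono) auto
    ultimately show ?thesis
      by (simp add: algebra_simps)
  qed
  have "G t \<le> G s"
  proof (rule DERIV_nonpos_imp_decreasing_open[OF \<open>s \<le> t\<close>])
    show "continuous_on {s..t} G"
      using dG by (rule DERIV_continuous_on)
    show "\<exists>y. (G has_real_derivative y) (at r) \<and> y \<le> 0" if "s < r" "r < t" for r
      using dG[of r] dG_nonpos[of r] that by (auto simp: at_within_Icc_at)
  qed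
  moreover have "ln (x t) \<le> G t"
    by (simp add: G_def)
  moreover have "(max (v s) 0)\<^sup>2 \<le> (v s)\<^sup>2"
    by (auto simp: max_def)
  then have "G s \<le> pi / 2 * (v s)\<^sup>2 + ln (x s)"
    unfolding G_def by (intro add_right_mono mult_left_mono) auto
  ultimately have "ln (x t) \<le> ln (x s * exp (pi / 2 * (v s)\<^sup>2))"
    using pos[of s] \<open>s \<le> t\<close> by (simp add: ln_mult)
  then show ?thesis
    using pos[of s] pos[of t] \<open>s \<le> t\<close> by (subst (asm) ln_le_cancel_iff) auto
qed

lemma log_attraction_bound:
  fixes x v a :: "real \<Rightarrow> real"
  assumes I: "is_interval I" and "s \<in> I" "t \<in> I"
    and x: "\<And>r. r \<in> I \<Longrightarrow> (x has_real_derivative v r) (at r within I)"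
    and v: "\<And>r. r \<in> I \<Longrightarrow> (v has_real_derivative a r) (at r within I)"
    and pos: "\<And>r. r \<in> I \<Longrightarrow> x r > 0"
    and a: "\<And>r. r \<in> I \<Longrightarrow> pi * a r * x r \<le> - 1"
  shows "x t \<le> x s * exp (pi / 2 * (v s)\<^sup>2)"
proof (cases "s \<le> t")
  case True
  have sub: "{s..t} \<subseteq> I"
    using I \<open>s \<in> I\<close> \<open>t \<in> I\<close> by (meson atLeastAtMost_iff mem_is_interval_1_I subsetI)
  show ?thesis
    by (rule log_attraction_forward_bound[OF True, of x v a])
      (use sub pos a has_field_derivative_subset[OF x sub] has_field_derivative_subset[OF v sub]
        in blast)+
next
  case False
  have sub: "{t..s} \<subseteq> I"
    using I \<open>s \<in> I\<close> \<open>t \<in> I\<close> by (meson atLeastAtMost_iff mem_is_interval_1_I subsetI)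
  have reverse: "((\<lambda>r. f (- r)) has_real_derivative - D) (at r within {- s..- t})"
    if "(f has_real_derivative D) (at (- r) within I)" for f :: "real \<Rightarrow> real" and D r
  proof -
    have "(uminus has_real_derivative - 1) (at r within {- s..- t})"
      by (auto intro!: derivative_eq_intros)
    moreover have "(f has_real_derivative D) (at (- r) within uminus ` {- s..- t})"
      using that sub by (auto intro: has_field_derivative_subset)
    ultimately show ?thesis
      using DERIV_image_chain[of f D uminus r "{- s..- t}" "- 1"] by (simp add: o_def)
  qed
  \<comment> \<open>The time-reversed motion has the same acceleration and the opposite velocity.\<close>
  have "x (- (- t)) \<le> x (- (- s)) * exp (pi / 2 * (- v (- (- s)))\<^sup>2)"
  proof (rule log_attraction_forward_bound
      [of "- s" "- t" "\<lambda>r. x (- r)" "\<lambda>r. - v (- r)" "\<lambda>r. a (- r)"])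
    fix r assume "r \<in> {- s..- t}"
    then have r: "- r \<in> I"
      using sub by auto
    show "((\<lambda>r. x (- r)) has_real_derivative - v (- r)) (at r within {- s..- t})"
      using x[OF r] by (rule reverse)
    show "((\<lambda>r. - v (- r)) has_real_derivative a (- r)) (at r within {- s..- t})"
      using DERIV_minus[OF reverse[OF v[OF r]]] by simp
    show "x (- r) > 0" "pi * a (- r) * x (- r) \<le> - 1"
      using r by (auto intro: pos a)
  qed (use False in auto)
  then show ?thesis
    by simp
qed

text \<open>
  The hypothesis on \<open>a\<close> forces \<open>x\<close> to be nonzero, hence of constant sign on \<open>I\<close>, so that the
  bound on \<open>x\<close> applies either to \<open>x\<close> or to \<open>- x\<close>.
\<close>

lemma log_attraction_bounded:
  fixes x v a :: "real \<Rightarrow> real"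
  assumes I: "is_interval I"
    and x: "\<And>r. r \<in> I \<Longrightarrow> (x has_real_derivative v r) (at r within I)"
    and v: "\<And>r. r \<in> I \<Longrightarrow> (v has_real_derivative a r) (at r within I)"
    and a: "\<And>r. r \<in> I \<Longrightarrow> pi * a r * x r \<le> - 1"
  shows "bounded (x ` I)"
proof (cases "I = {}")
  case False
  then obtain s where s: "s \<in> I"
    by auto
  have "is_interval (x ` I)"
    using I DERIV_continuous_on[of I x v] x
    by (metis connected_continuous_image is_interval_connected_1)
  moreover have "0 \<notin> x ` I"
    using a by fastforce
  ultimately have sign: "(\<forall>r \<in> I. x r > 0) \<or> (\<forall>r \<in> I. - x r > 0)"
    unfolding is_interval_1 by (smt (verit) image_eqI)
  have "\<bar>x t\<bar> \<le> \<bar>x s\<bar> * exp (pi / 2 * (v s)\<^sup>2)" if t: "t \<in> I" for t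
    using sign
  proof
    assume "\<forall>r \<in> I. x r > 0"
    moreover from this have "x t \<le> x s * exp (pi / 2 * (v s)\<^sup>2)"
      by (intro log_attraction_bound[OF I s t x v _ a]) auto
    ultimately show ?thesis
      using s t by (simp add: abs_of_pos)
  next
    assume "\<forall>r \<in> I. - x r > 0"
    moreover from this have "- x t \<le> - x s * exp (pi / 2 * (- v s)\<^sup>2)"
      by (intro log_attraction_bound[OF I s t, of "\<lambda>r. - x r" "\<lambda>r. - v r" "\<lambda>r. - a r"])
        (auto intro: DERIV_minus x v a)
    ultimately show ?thesis
      using s t by (simp add: abs_of_neg)
  qed
  then show ?thesis
    by (auto intro!: boundedI)
qed simp

text \<open>
  The value \<open>- 1\<close> is the contribution of \<open>ln \<bar>x\<^sub>i\<bar>\<close>; the factor \<open>\<parallel>x\<parallel>\<close> of the potential only adds to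
  the attraction.
\<close>

lemma gradient_potential_times_coordinate:
  assumes x: "collision_free x" and g: "GDERIV potential x :> g"
  shows "g $ i * x $ i \<le> - 1"
proof -
  have nz: "x $ k \<noteq> 0" for k
    using x exhaust_2[of k] by (auto simp: collision_free_def)
  define S where "S = {y :: real ^ 2. y $ 1 \<noteq> 0 \<and> y $ 2 \<noteq> 0}"
  have "open S"
    unfolding S_def by (intro open_Collect_conj open_Collect_neq continuous_intros)
  have "x \<in> S"
    using nz by (simp add: S_def)
  have "x \<noteq> 0"
    using nz[of 1] by auto
  define D where "D h = - (inner h (sgn x) / norm x + h $ 1 / x $ 1 + h $ 2 / x $ 2)"
    for h :: "real ^ 2"
  \<comment> \<open>On \<open>S\<close> the logarithm splits into a sum; writing \<open>ln \<bar>z\<bar>\<close> as \<open>ln (z\<^sup>2) / 2\<close> makes it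
    differentiable on both sides of zero at once.\<close>
  have "((\<lambda>y. - (ln 8 + ln (norm y) + ln ((y $ 1)\<^sup>2) / 2 + ln ((y $ 2)\<^sup>2) / 2)) has_derivative D)
    (at x)"
    unfolding D_def using nz[of 1] nz[of 2] \<open>x \<noteq> 0\<close>
    by (auto intro!: derivative_eq_intros has_derivative_norm
        bounded_linear.has_derivative[OF bounded_linear_vec_nth]
        simp: divide_simps power2_eq_square fun_eq_iff not_sum_squares_lt_zero zero_less_mult_iff)
  then have "(potential has_derivative D) (at x)"
  proof (rule has_derivative_transform_within_open[OF _ \<open>open S\<close> \<open>x \<in> S\<close>])
    fix y assume "y \<in> S"
    moreover from this have "y \<noteq> 0"
      by (auto simp: S_def)
    moreover have "ln (z\<^sup>2) / 2 = ln \<bar>z\<bar>" if "z \<noteq> 0" for z :: real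
      using that ln_realpow[of "\<bar>z\<bar>" 2] by simp
    ultimately show "- (ln 8 + ln (norm y) + ln ((y $ 1)\<^sup>2) / 2 + ln ((y $ 2)\<^sup>2) / 2) = potential y"
      by (simp add: potential_def S_def ln_mult abs_mult)
  qed
  then have "D = (\<lambda>h. inner h g)"
    using g has_derivative_unique unfolding gderiv_def by blast
  then have "g $ i * x $ i = D (axis i (x $ i))"
    by (simp add: inner_axis' mult.commute)
  also have "\<dots> = - ((x $ i)\<^sup>2 / (norm x)\<^sup>2 + 1)"
  proof -
    have "inner (axis i (x $ i)) (sgn x) / norm x = (x $ i)\<^sup>2 / (norm x)\<^sup>2"
      by (simp add: inner_axis' sgn_div_norm power2_eq_square divide_simps)
    moreover have "axis i (x $ i) $ 1 / x $ 1 + axis i (x $ i) $ 2 / x $ 2 = 1"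
      using exhaust_2[of i] nz by (auto simp: axis_def)
    ultimately show ?thesis
      by (simp add: D_def)
  qed
  also have "\<dots> \<le> - 1"
    by simp
  finally show ?thesis .
qed

lemma bounded_image_interval_minus_finite:
  fixes f :: "real \<Rightarrow> 'a::metric_space"
  assumes "finite Y" "is_interval J"
    and "\<And>I. is_interval I \<Longrightarrow> I \<subseteq> J - Y \<Longrightarrow> bounded (f ` I)"
  shows "bounded (f ` J)"
  using assms
proof (induction Y arbitrary: J rule: finite_induct)
  case empty
  then show ?case by auto
next
  case (insert y Y)
  have part: "bounded (f ` (J \<inter> K))" if "is_interval K" "y \<notin> K" for K
  proof (rule insert.IH)
    show "is_interval (J \<inter> K)"
      using insert.prems(1) that(1) by (rule is_interval_Int)
    show "bounded (f ` I)" if "is_interval I" "I \<subseteq> J \<inter> K - Y" for I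
      using that \<open>y \<notin> K\<close> by (intro insert.prems(2)) auto
  qed
  have "bounded (f ` (J \<inter> {..<y}))" "bounded (f ` (J \<inter> {y<..}))"
    by (simp_all add: part is_interval_oi is_interval_io)
  then have "bounded (f ` (J \<inter> {..<y} \<union> J \<inter> {y<..} \<union> {y}))"
    by (simp add: image_Un)
  moreover have "J \<subseteq> J \<inter> {..<y} \<union> J \<inter> {y<..} \<union> {y}"
    by (auto simp: neq_iff)
  ultimately show ?case
    by (blast intro: bounded_subset)
qed

theorem theorem6p5:
  fixes J :: "real set" and q :: "real \<Rightarrow> real ^ 2"
  assumes "generalized_solution J q"
  shows "bounded {q \<sigma> | \<sigma>. \<sigma> \<in> J}"
proof -
  obtain Y v where "is_interval J" "finite Y" and motion: "solves_motion J Y q v"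
    using assms by (auto simp: generalized_solution_def)
  then obtain a where a: "\<And>t. t \<in> J - Y \<Longrightarrow> collision_free (q t) \<and>
      (q has_vector_derivative v t) (at t within J) \<and>
      (v has_vector_derivative a t) (at t within J) \<and> GDERIV potential (q t) :> pi *\<^sub>R a t"
    by (auto simp: solves_motion_def)
  have component: "((\<lambda>t. f t $ i) has_real_derivative f' $ i) (at t within I)"
    if "(f has_vector_derivative f') (at t within J)" "I \<subseteq> J"
    for f :: "real \<Rightarrow> real ^ 2" and f' t i I
    using bounded_linear.has_vector_derivative[OF bounded_linear_vec_nth that(1)] that(2)
    by (auto simp: has_real_derivative_iff_has_vector_derivative
        intro: has_vector_derivative_within_subset)
  have "bounded (q ` J)"
    using \<open>finite Y\<close> \<open>is_interval J\<close>
  proof (rule bounded_image_interval_minus_finite)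
    fix I assume I: "is_interval I" "I \<subseteq> J - Y"
    have "bounded ((\<lambda>t. q t $ i) ` I)" for i
    proof (rule log_attraction_bounded[OF I(1)])
      fix r assume "r \<in> I"
      then have r: "r \<in> J - Y"
        using I by auto
      show "((\<lambda>t. q t $ i) has_real_derivative v r $ i) (at r within I)"
        "((\<lambda>t. v t $ i) has_real_derivative a r $ i) (at r within I)"
        using a[OF r] I(2) by (auto intro: component)
      show "pi * a r $ i * q r $ i \<le> - 1"
        using gradient_potential_times_coordinate[of "q r" "pi *\<^sub>R a r" i] a[OF r] by simp
    qed
    then have "\<exists>B. \<forall>t \<in> I. \<bar>q t $ i\<bar> \<le> B" for i
      by (simp add: bounded_iff)
    then obtain B where "\<And>i t. t \<in> I \<Longrightarrow> \<bar>q t $ i\<bar> \<le> B i"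
      by metis
    then have "norm (q t) \<le> (\<Sum>i \<in> UNIV. B i)" if "t \<in> I" for t
      using that by (intro order_trans[OF norm_le_l1_cart] sum_mono)
    then show "bounded (q ` I)"
      by (auto intro!: boundedI)
  qed
  then show ?thesis
    by (simp add: Setcompr_eq_image)
qed

end
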